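(* Let $t$ and $l$ be positive integers. The number of $2t$-core partitions into exactly $l$ parts, all of which are even, equals the number of $t$-core partitions into exactly $l$ parts.
   Context: A partition is a finite nonincreasing sequence $\lambda=(\lambda_1,\dots,\lambda_l)$ of positive integers (its parts). The Ferrers diagram of $\lambda$ has $\lambda_j$ nodes in row $j$ (left justified). The hook length of a node is the number of nodes consisting of the node itself, the nodes to its right in the same row and the nodes below it in the same column. $\lambda$ is a $t$-core partition if no node has hook length $t$ (equivalently, no hook length is divisible by $t$). *)

theory Defs
  imports Main
begin

definition is_partition :: "nat list \<Rightarrow> bool" where
  "is_partition xs \<longleftrightarrow> sorted_wrt (\<ge>) xs \<and> (\<forall>x\<in>set xs. 0 < x)"

(* Nodes are (row, column) pairs, both counted from 0; row i + 1 lies below row i. *)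
definition ferrers :: "nat list \<Rightarrow> (nat \<times> nat) set" where
  "ferrers xs = {(i, j). i < length xs \<and> j < xs ! i}"

definition hook :: "nat list \<Rightarrow> nat \<times> nat \<Rightarrow> (nat \<times> nat) set" where
  "hook xs v = {w \<in> ferrers xs.
     fst w = fst v \<and> snd v \<le> snd w \<or> snd w = snd v \<and> fst v \<le> fst w}"

definition hook_length :: "nat list \<Rightarrow> nat \<times> nat \<Rightarrow> nat" where
  "hook_length xs v = card (hook xs v)"

definition core_partition :: "nat \<Rightarrow> nat list \<Rightarrow> bool" where
  "core_partition t xs \<longleftrightarrow> is_partition xs \<and> (\<forall>v\<in>ferrers xs. hook_length xs v \<noteq> t)"

end

theory Submission
  imports Defs
begin

text \<open>
  Attach to the row of length \<open>x\<close> that has \<open>k\<close> rows below it the bead \<open>b = x + k\<close>. The hook lengths in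
  that row are the differences \<open>b - c\<close>, where \<open>c < b\<close> runs through the gaps (the naturals that are not
  beads), so a partition is a \<open>t\<close>-core iff no bead lies exactly \<open>t\<close> above a gap.

  Replace each row of a \<open>t\<close>-core by its number of hook lengths below \<open>t\<close>, that is, by the number of gaps
  strictly between \<open>b - t\<close> and \<open>b\<close>. As an admissible new top bead moves upwards, this number grows by
  exactly one from each admissible place to the next, beginning with the value for the previous row
  (for the bottom row with 0, which belongs to an empty row) and ending with \<open>t - 1\<close>. Hence
  a \<open>t\<close>-core can be built from the bottom row upwards from any weakly increasing sequence of numbers in \<open>{1..<t}\<close>, in exactly one way: \<open>t\<close>-cores with \<open>l\<close> parts correspond
  to partitions with \<open>l\<close> parts that are all less than \<open>t\<close> (\<open>short_hooks_inj\<close>, \<open>short_hooks_surj\<close>).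

  The gaps below a bead are as many as the nodes of its row. So the number attached to a row is the
  length of that row minus the length of the row whose bead is \<open>b - t\<close> (or minus nothing, if \<open>b < t\<close>).
  Working upwards, all parts of a core are even iff all the attached numbers are even
  (\<open>dvd_short_hooks_iff\<close>). Therefore the \<open>2t\<close>-cores with \<open>l\<close> even parts correspond to the partitions
  with \<open>l\<close> even parts less than \<open>2t\<close>; halving gives the partitions with \<open>l\<close> parts less than \<open>t\<close>, which
  correspond to the \<open>t\<close>-cores with \<open>l\<close> parts.
\<close>

section \<open>Hook lengths and beads\<close>

fun beads :: "nat list \<Rightarrow> nat set" where
  "beads [] = {}"
| "beads (x # xs) = insert (x + length xs) (beads xs)"

text \<open>The place of the bead of a new top row that is as long as the present top row (or empty).\<close>

fun top_bound :: "nat list \<Rightarrow> nat" where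
  "top_bound [] = 0"
| "top_bound (x # xs) = Suc (x + length xs)"

lemma is_partition_Nil [simp]: "is_partition []"
  by (simp add: is_partition_def)

lemma is_partition_Cons:
  "is_partition (x # xs) \<longleftrightarrow> is_partition xs \<and> 0 < x \<and> top_bound xs \<le> x + length xs"
  by (cases xs) (auto simp: is_partition_def)

lemma is_partition_ConsD:
  assumes "is_partition (x # xs)"
  shows "is_partition xs" "0 < x" "\<forall>y\<in>set xs. y \<le> x"
  using assms by (auto simp: is_partition_def)

lemma beads_less_top_bound: "is_partition xs \<Longrightarrow> b \<in> beads xs \<Longrightarrow> b < top_bound xs"
proof (induction xs)
  case (Cons x xs)
  then show ?case
    by (fastforce simp: is_partition_Cons)
qed simp

lemma finite_beads [simp]: "finite (beads xs)"
  by (induction xs) auto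

lemma card_beads: "is_partition xs \<Longrightarrow> card (beads xs) = length xs"
proof (induction xs)
  case (Cons x xs)
  then have "x + length xs \<notin> beads xs"
    using beads_less_top_bound by (fastforce simp: is_partition_Cons)
  with Cons show ?case
    by (simp add: is_partition_Cons)
qed simp

text \<open>
  Walk along the boundary of the diagram from its lower left end: each vertical step carries a bead,
  each horizontal step a gap. The horizontal step below column \<open>j\<close> comes after \<open>j\<close> horizontal steps and
  after one vertical step for each row that ends at or before column \<open>j\<close>.
\<close>

lemma gaps_eq_range:
  assumes "is_partition xs"
  shows "- beads xs = range (\<lambda>j. j + length (filter (\<lambda>y. y \<le> j) xs))"
  using assms
proof (induction xs)
  case Nil
  then show ?case by simp
next
  case (Cons x xs)
  let ?c = "\<lambda>ys j. j + length (filter (\<lambda>y. y \<le> j) ys)"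
  note part = is_partition_ConsD[OF Cons.prems]
  have full: "?c xs j = j + length xs" if "x \<le> j" for j
  proof -
    have "filter (\<lambda>y. y \<le> j) xs = xs"
      using part(3) that by (auto simp: filter_id_conv)
    then show ?thesis by simp
  qed
  have below: "?c xs j < x + length xs" if "j < x" for j
    using that length_filter_le[of "\<lambda>y. y \<le> j" xs] by linarith
  have "range (?c (x # xs)) = range (?c xs) - {x + length xs}"
  proof (intro equalityI subsetI)
    fix c assume "c \<in> range (?c (x # xs))"
    then obtain j where j: "c = ?c (x # xs) j" by auto
    show "c \<in> range (?c xs) - {x + length xs}"
    proof (cases "j < x")
      case True
      then show ?thesis using j below[of j] by auto
    next
      case False
      then have "c = ?c xs (Suc j)" "c \<noteq> x + length xs"
        using j full[of j] full[of "Suc j"] by auto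
      then show ?thesis by blast
    qed
  next
    fix c assume c: "c \<in> range (?c xs) - {x + length xs}"
    then obtain j where j: "c = ?c xs j" by auto
    show "c \<in> range (?c (x # xs))"
    proof (cases "j < x")
      case True
      then have "c = ?c (x # xs) j" using j by simp
      then show ?thesis by blast
    next
      case False
      with c j full[of j] have "x < j" by (cases "j = x") auto
      then have "c = ?c (x # xs) (j - 1)"
        using j full[of j] full[of "j - 1"] by auto
      then show ?thesis by blast
    qed
  qed
  moreover have "- beads (x # xs) = - beads xs - {x + length xs}" by auto
  ultimately show ?case
    using Cons.IH[OF part(1)] by (simp only:)
qed

lemma ferrers_Cons:
  "ferrers (x # xs) = {0} \<times> {..<x} \<union> map_prod Suc id ` ferrers xs"
proof (intro set_eqI)
  fix v :: "nat \<times> nat"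
  obtain i j where "v = (i, j)" by (cases v)
  then show "v \<in> ferrers (x # xs) \<longleftrightarrow> v \<in> {0} \<times> {..<x} \<union> map_prod Suc id ` ferrers xs"
    by (cases i) (force simp: ferrers_def)+
qed

lemma hook_length_Cons_Suc: "hook_length (x # xs) (Suc i, j) = hook_length xs (i, j)"
proof -
  have "hook (x # xs) (Suc i, j) = map_prod Suc id ` hook xs (i, j)"
    by (force simp: hook_def ferrers_Cons)
  moreover have "inj_on (map_prod Suc (id :: nat \<Rightarrow> nat)) A" for A
    by (auto simp: inj_on_def)
  ultimately show ?thesis
    by (simp add: hook_length_def card_image)
qed

lemma hook_length_Cons_0:
  assumes "j < x"
  shows "hook_length (x # xs) (0, j) = x - j + length (filter (\<lambda>y. j < y) xs)"
proof -
  let ?arm = "{0 :: nat} \<times> {j..<x}"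
  let ?leg = "(\<lambda>i. (Suc i, j)) ` {i. i < length xs \<and> j < xs ! i}"
  have "hook (x # xs) (0, j) = ?arm \<union> ?leg"
  proof (intro set_eqI)
    fix v :: "nat \<times> nat"
    obtain i k where "v = (i, k)" by (cases v)
    then show "v \<in> hook (x # xs) (0, j) \<longleftrightarrow> v \<in> ?arm \<union> ?leg"
      using assms by (cases i) (auto simp: hook_def ferrers_def)
  qed
  moreover have "card (?arm \<union> ?leg) = card ?arm + card ?leg"
    by (rule card_Un_disjoint) auto
  moreover have "card ?leg = length (filter (\<lambda>y. j < y) xs)"
    by (simp add: card_image inj_on_def length_filter_conv_card)
  ultimately show ?thesis
    by (simp add: hook_length_def card_cartesian_product)
qed

text \<open>
  The hook of a node in the top row is measured from the boundary step below its column (a gap) to the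
  top bead.
\<close>

lemma top_row_hook_length_iff:
  assumes "is_partition (x # xs)" and "0 < t"
  shows "(\<exists>j<x. hook_length (x # xs) (0, j) = t) \<longleftrightarrow> (\<exists>c. c \<notin> beads xs \<and> c + t = x + length xs)"
proof -
  note part = is_partition_ConsD[OF assms(1)]
  let ?c = "\<lambda>j. j + length (filter (\<lambda>y. y \<le> j) xs)"
  have split: "length (filter (\<lambda>y. y \<le> j) xs) + length (filter (\<lambda>y. j < y) xs) = length xs" for j
    using sum_length_filter_compl[of "\<lambda>y. y \<le> j" xs] by (simp add: not_le)
  have hook_iff: "hook_length (x # xs) (0, j) = t \<longleftrightarrow> ?c j + t = x + length xs" if "j < x" for j
    using split[of j] that by (auto simp: hook_length_Cons_0)
  have "j < x" if "?c j + t = x + length xs" for j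
  proof (rule ccontr)
    assume "\<not> j < x"
    then have "filter (\<lambda>y. y \<le> j) xs = xs"
      using part(3) by (auto simp: filter_id_conv)
    with that \<open>\<not> j < x\<close> \<open>0 < t\<close> show False by simp
  qed
  then have "(\<exists>j<x. hook_length (x # xs) (0, j) = t) \<longleftrightarrow> (\<exists>j. ?c j + t = x + length xs)"
    using hook_iff by blast
  also have "\<dots> \<longleftrightarrow> (\<exists>c. c \<in> - beads xs \<and> c + t = x + length xs)"
    unfolding gaps_eq_range[OF part(1)] by auto
  finally show ?thesis by simp
qed

lemma core_partition_Nil [simp]: "core_partition t []"
  by (simp add: core_partition_def ferrers_def)

lemma core_partition_Cons:
  assumes "0 < t"
  shows "core_partition t (x # xs) \<longleftrightarrow>
    core_partition t xs \<and> is_partition (x # xs) \<and> (\<forall>c. c \<notin> beads xs \<longrightarrow> c + t \<noteq> x + length xs)"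
proof (cases "is_partition (x # xs)")
  case True
  have "(\<forall>v\<in>ferrers (x # xs). hook_length (x # xs) v \<noteq> t) \<longleftrightarrow>
      (\<forall>j<x. hook_length (x # xs) (0, j) \<noteq> t) \<and> (\<forall>v\<in>ferrers xs. hook_length xs v \<noteq> t)"
    unfolding ferrers_Cons ball_Un by (auto simp: hook_length_Cons_Suc)
  then show ?thesis
    using top_row_hook_length_iff[OF True assms] True is_partition_ConsD(1)[OF True]
    unfolding core_partition_def by blast
next
  case False
  then show ?thesis by (simp add: core_partition_def)
qed

section \<open>Gaps in a window of fixed width\<close>

definition window :: "nat \<Rightarrow> nat set \<Rightarrow> nat \<Rightarrow> nat set" where
  "window t N x = {c \<in> N. c < x \<and> x < c + t}"

text \<open>In a core, \<open>N\<close> is the set of gaps and the admissible numbers are the allowed places for new beads.\<close>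

definition admissible :: "nat \<Rightarrow> nat set \<Rightarrow> nat \<Rightarrow> bool" where
  "admissible t N x \<longleftrightarrow> (\<forall>c\<in>N. c + t \<noteq> x)"

lemma finite_window [simp]: "finite (window t N x)"
  by (rule finite_subset[of _ "{..<x}"]) (auto simp: window_def)

lemma card_window_less: "0 < t \<Longrightarrow> card (window t N x) < t"
proof -
  assume "0 < t"
  have "window t N x \<subseteq> {x - (t - 1)..<x}"
    by (auto simp: window_def)
  then have "card (window t N x) \<le> card {x - (t - 1)..<x}"
    by (intro card_mono) auto
  also have "\<dots> < t" using \<open>0 < t\<close> by auto
  finally show ?thesis .
qed

text \<open>
  Sliding the window by one step past an element \<open>x\<close> of \<open>N\<close> lets \<open>x\<close> in, and pushes an element out
  exactly if \<open>Suc x - t\<close> belongs to \<open>N\<close>.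
\<close>

lemma card_window_Suc:
  assumes "x \<in> N" and "0 < t"
  shows "card (window t N (Suc x)) =
    (if admissible t N (Suc x) then Suc (card (window t N x)) else card (window t N x))"
proof -
  let ?out = "{c \<in> N. c + t = Suc x}"
  have "insert x (window t N x) = window t N (Suc x) \<union> ?out"
    using assms by (auto simp: window_def less_Suc_eq)
  moreover have "card (insert x (window t N x)) = Suc (card (window t N x))"
    by (subst card_insert_disjoint) (auto simp: window_def)
  moreover have "finite ?out"
    by (rule finite_subset[of _ "{..Suc x}"]) auto
  then have "card (window t N (Suc x) \<union> ?out) = card (window t N (Suc x)) + card ?out"
    by (intro card_Un_disjoint) (auto simp: window_def)
  moreover have "card ?out = (if admissible t N (Suc x) then 0 else 1)"
  proof (cases "admissible t N (Suc x)")
    case True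
    then have "?out = {}" by (auto simp: admissible_def)
    with True show ?thesis by (simp only: card.empty if_True)
  next
    case False
    then obtain c where "c \<in> N" "c + t = Suc x" by (auto simp: admissible_def)
    then have "?out = {c}" by auto
    then have "card ?out = 1" by (simp only: card.empty card_insert_disjoint) simp
    with False show ?thesis by (simp only: if_False)
  qed
  ultimately show ?thesis by (auto split: if_splits)
qed

lemma card_window_mono:
  assumes "{m..} \<subseteq> N" "0 < t" "m \<le> x" "x \<le> y"
  shows "card (window t N x) \<le> card (window t N y)"
  using assms(4)
proof (induction y rule: dec_induct)
  case (step y)
  then have "y \<in> N" using assms by auto
  then show ?case
    using step card_window_Suc[of y N t] \<open>0 < t\<close> by auto
qed simp

text \<open>The count never drops, and the step into an admissible \<open>y\<close> raises it.\<close>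

lemma card_window_strict_mono:
  assumes "{m..} \<subseteq> N" "0 < t" "m \<le> x" "x < y" "admissible t N y"
  shows "card (window t N x) < card (window t N y)"
proof (cases y)
  case (Suc z)
  then have "z \<in> N" "x \<le> z" using assms by auto
  then show ?thesis
    using card_window_mono[of m N t x z] card_window_Suc[of z N t] assms Suc by simp
qed (use assms in simp)

text \<open>
  The set on the right is the window for a bead at \<open>m - 1\<close> (that bead itself is not in \<open>N\<close>), the last
  one placed so far.
\<close>

lemma window_at_bound:
  assumes "0 < t"
  shows "admissible t N m \<Longrightarrow> window t N m = {c \<in> N. c < m \<and> m \<le> c + t}"
    and "card {c \<in> N. c < m \<and> m \<le> c + t} \<le> Suc (card (window t N m))"
    and "card (window t N m) \<le> card {c \<in> N. c < m \<and> m \<le> c + t}"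
proof -
  let ?W = "{c \<in> N. c < m \<and> m \<le> c + t}"
  show "admissible t N m \<Longrightarrow> window t N m = ?W"
    by (auto simp: window_def admissible_def le_less)
  have "?W \<subseteq> insert (m - t) (window t N m)"
    by (auto simp: window_def)
  then have "card ?W \<le> card (insert (m - t) (window t N m))"
    by (intro card_mono) auto
  then show "card ?W \<le> Suc (card (window t N m))"
    by (simp add: card_insert_if split: if_splits)
  have "finite ?W" by (rule finite_subset[of _ "{..<m}"]) auto
  then show "card (window t N m) \<le> card ?W"
    by (intro card_mono) (auto simp: window_def)
qed

text \<open>
  The count at \<open>m\<close> itself may be one too small, but then \<open>m\<close> is not admissible, and the step into the
  next admissible place makes up for it.
\<close>

lemma admissible_window_lower_bound:
  assumes "{m..} \<subseteq> N" "0 < t" "m \<le> x" "admissible t N x"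
  shows "card {c \<in> N. c < m \<and> m \<le> c + t} \<le> card (window t N x)"
proof (cases "x = m")
  case True
  then show ?thesis using window_at_bound(1)[OF assms(2)] assms by simp
next
  case False
  then have "card (window t N m) < card (window t N x)"
    using card_window_strict_mono[of m N t m x] assms by simp
  then show ?thesis using window_at_bound(2)[OF assms(2), of N m] by linarith
qed

text \<open>
  The count rises in unit steps and only at admissible places, and it is \<open>t - 1\<close> once the window has
  left the elements below \<open>m\<close> behind. So the first place where the count reaches \<open>v\<close> is admissible.
\<close>

lemma admissible_window_exists:
  assumes "{m..} \<subseteq> N" "0 < t" "card {c \<in> N. c < m \<and> m \<le> c + t} \<le> v" "v < t"
  shows "\<exists>x\<ge>m. admissible t N x \<and> card (window t N x) = v"
proof -
  let ?P = "\<lambda>x. m \<le> x \<and> v \<le> card (window t N x)"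
  have "window t N (m + t - 1) = {m..<m + t - 1}"
    using assms(1,2) by (auto simp: window_def)
  then have "?P (m + t - 1)" using assms by auto
  then have P: "?P (Least ?P)" by (rule LeastI)
  define x where "x = Least ?P"
  show ?thesis
  proof (cases "x = m")
    case True
    have *: "card (window t N m) = card {c \<in> N. c < m \<and> m \<le> c + t}"
      using P True x_def window_at_bound(3)[OF assms(2), of N m] assms(3) by simp
    have "admissible t N m"
    proof (rule ccontr)
      assume "\<not> admissible t N m"
      then obtain c where c: "c \<in> N" "c + t = m" by (auto simp: admissible_def)
      have "finite {c \<in> N. c < m \<and> m \<le> c + t}" by (rule finite_subset[of _ "{..<m}"]) auto
      moreover have "window t N m \<subseteq> {c \<in> N. c < m \<and> m \<le> c + t}"
        by (auto simp: window_def)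
      moreover have "c \<in> {c \<in> N. c < m \<and> m \<le> c + t}" "c \<notin> window t N m"
        using c \<open>0 < t\<close> by (auto simp: window_def)
      ultimately have "card (window t N m) < card {c \<in> N. c < m \<and> m \<le> c + t}"
        by (intro psubset_card_mono psubsetI) blast+
      then show False using * by simp
    qed
    then show ?thesis using * P True x_def assms(3) by auto
  next
    case False
    then obtain z where z: "x = Suc z" "m \<le> z"
      using P unfolding x_def[symmetric] by (cases x) auto
    then have "\<not> ?P z" unfolding x_def by (metis lessI not_less_Least x_def)
    then have "card (window t N z) < v" using z by simp
    moreover have "v \<le> card (window t N (Suc z))" using P z x_def by simp
    moreover have "z \<in> N" using z assms(1) by auto
    ultimately have "admissible t N (Suc z) \<and> card (window t N (Suc z)) = v"
      using card_window_Suc[of z N t] assms(2) by (auto split: if_splits)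
    then show ?thesis using z by (metis le_SucI)
  qed
qed

section \<open>Cores and partitions with bounded parts\<close>

text \<open>For a \<open>t\<close>-core, the numbers of nodes with hook length less than \<open>t\<close> in the rows.\<close>

fun short_hooks :: "nat \<Rightarrow> nat list \<Rightarrow> nat list" where
  "short_hooks t [] = []"
| "short_hooks t (x # xs) = card (window t (- beads xs) (x + length xs)) # short_hooks t xs"

lemma length_short_hooks [simp]: "length (short_hooks t xs) = length xs"
  by (induction xs) auto

lemma core_partition_Cons_admissible:
  assumes "0 < t"
  shows "core_partition t (x # xs) \<longleftrightarrow> core_partition t xs \<and> 0 < x \<and>
    top_bound xs \<le> x + length xs \<and> admissible t (- beads xs) (x + length xs)"
  unfolding core_partition_Cons[OF assms] is_partition_Cons admissible_def
  by (auto simp: core_partition_def[of t xs])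

lemma gaps_above_top_bound: "core_partition t xs \<Longrightarrow> {top_bound xs..} \<subseteq> - beads xs"
  using beads_less_top_bound by (fastforce simp: core_partition_def)

text \<open>
  The lower bound for the next entry that comes from sliding windows is the entry of the row just
  placed; the bead of that row is no longer a gap, but it was not counted in its own window either.
\<close>

lemma card_gaps_below_top_bound:
  "card {c \<in> - beads xs. c < top_bound xs \<and> top_bound xs \<le> c + t} =
    (case short_hooks t xs of [] \<Rightarrow> 0 | w # _ \<Rightarrow> w)"
proof (cases xs)
  case (Cons y ys)
  have "{c \<in> - beads xs. c < top_bound xs \<and> top_bound xs \<le> c + t} =
      window t (- beads ys) (y + length ys)"
    by (auto simp: Cons window_def)
  then show ?thesis by (simp add: Cons)
qed simp

text \<open>The case expression is the one by which \<open>card_gaps_below_top_bound\<close> bounds the next entry.\<close>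

lemma is_partition_Cons_case:
  "is_partition (w # ws) \<longleftrightarrow>
    is_partition ws \<and> 0 < w \<and> (case ws of [] \<Rightarrow> 0 | v # _ \<Rightarrow> v) \<le> w"
  by (cases ws) (auto simp: is_partition_Cons)

lemma short_hooks_bounded_partition:
  assumes "0 < t" and "core_partition t xs"
  shows "is_partition (short_hooks t xs) \<and> (\<forall>w\<in>set (short_hooks t xs). w < t)"
  using assms(2)
proof (induction xs)
  case Nil
  then show ?case by simp
next
  case (Cons x xs)
  let ?N = "- beads xs" and ?b = "x + length xs"
  have core: "core_partition t xs" "0 < x" "top_bound xs \<le> ?b" "admissible t ?N ?b"
    using Cons.prems by (auto simp: core_partition_Cons_admissible[OF assms(1)])
  have IH: "is_partition (short_hooks t xs)" "\<forall>w\<in>set (short_hooks t xs). w < t"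
    using Cons.IH core(1) by auto
  have ge: "(case short_hooks t xs of [] \<Rightarrow> 0 | w # _ \<Rightarrow> w) \<le> card (window t ?N ?b)"
    using admissible_window_lower_bound[OF gaps_above_top_bound[OF core(1)] assms(1) core(3,4)]
    unfolding card_gaps_below_top_bound .
  have "0 < card (window t ?N ?b)"
  proof (cases xs)
    case Nil
    \<comment> \<open>In a single row all hook lengths from 1 to \<open>x\<close> occur, so \<open>x < t\<close> and column 0 is counted.\<close>
    have "x < t"
      using core(4) Nil by (metis Compl_empty_eq UNIV_I add.right_neutral admissible_def beads.simps(1)
          le_add_diff_inverse2 list.size(3) not_le)
    then have "0 \<in> window t ?N ?b" using core(2) Nil by (auto simp: window_def)
    then show ?thesis by (auto simp: card_gt_0_iff)
  next
    case (Cons y ys)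
    then show ?thesis using ge IH(1) by (auto simp: is_partition_def)
  qed
  then show ?case
    using IH ge card_window_less[OF assms(1)] by (simp add: is_partition_Cons_case)
qed

text \<open>The lower rows fix the gaps, and two admissible places have different counts.\<close>

lemma short_hooks_inj:
  assumes "0 < t"
  shows "core_partition t xs \<Longrightarrow> core_partition t ys \<Longrightarrow> short_hooks t xs = short_hooks t ys \<Longrightarrow> xs = ys"
proof (induction xs arbitrary: ys)
  case Nil
  then show ?case by (cases ys) auto
next
  case (Cons x xs)
  then obtain y ys' where ys: "ys = y # ys'" by (cases ys) auto
  note core = core_partition_Cons_admissible[OF assms]
  have tail: "xs = ys'" using Cons ys core by auto
  have *: "card (window t (- beads xs) (x + length xs)) = card (window t (- beads xs) (y + length xs))"
    using Cons.prems ys tail by simp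
  have "core_partition t xs" using Cons.prems core by simp
  then have "\<not> x + length xs < y + length xs" "\<not> y + length xs < x + length xs"
    using card_window_strict_mono[OF gaps_above_top_bound assms] * Cons.prems
    unfolding ys tail core by (metis less_irrefl)+
  then show ?case using tail ys by simp
qed

text \<open>Each entry, read from the bottom row upwards, is the count at some admissible place.\<close>

lemma short_hooks_surj:
  assumes "0 < t"
  shows "is_partition ws \<Longrightarrow> \<forall>w\<in>set ws. w < t \<Longrightarrow> \<exists>xs. core_partition t xs \<and> short_hooks t xs = ws"
proof (induction ws)
  case Nil
  then show ?case by (intro exI[of _ "[]"]) simp
next
  case (Cons w ws)
  then obtain xs where xs: "core_partition t xs" "short_hooks t xs = ws"
    by (auto simp: is_partition_Cons_case)
  have "card {c \<in> - beads xs. c < top_bound xs \<and> top_bound xs \<le> c + t} \<le> w"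
    unfolding card_gaps_below_top_bound using Cons.prems xs(2) by (simp add: is_partition_Cons_case)
  then obtain b where b: "top_bound xs \<le> b" "admissible t (- beads xs) b"
      "card (window t (- beads xs) b) = w"
    using admissible_window_exists[OF gaps_above_top_bound[OF xs(1)] assms] Cons.prems by auto
  have "length xs < b"
  proof (cases xs)
    case Nil
    \<comment> \<open>Place 0 would mean an empty bottom row; it has count 0, whereas \<open>w\<close> is positive.\<close>
    have "window t (- beads xs) 0 = {}" by (auto simp: window_def)
    then have "b \<noteq> 0"
      using b(3) Cons.prems(1) by (intro notI) (simp add: is_partition_Cons)
    then show ?thesis using Nil by simp
  next
    case (Cons y ys)
    then have "0 < y" using xs(1) by (simp add: core_partition_Cons_admissible[OF assms])
    then show ?thesis using b(1) Cons by simp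
  qed
  then have "core_partition t ((b - length xs) # xs)" "short_hooks t ((b - length xs) # xs) = w # ws"
    using xs b by (simp_all add: core_partition_Cons_admissible[OF assms])
  then show ?case by blast
qed

section \<open>Divisibility of the parts\<close>

lemma card_gaps_below_new_bead:
  assumes "is_partition (x # xs)"
  shows "card (- beads xs \<inter> {..<x + length xs}) = x"
proof -
  have part: "is_partition xs" "beads xs \<subseteq> {..<x + length xs}"
    using assms beads_less_top_bound by (fastforce simp: is_partition_Cons)+
  have "- beads xs \<inter> {..<x + length xs} = {..<x + length xs} - beads xs" by auto
  then show ?thesis
    using part by (simp add: card_Diff_subset card_beads)
qed

text \<open>Each column of the row of \<open>b\<close> has its horizontal boundary step, a gap, before the step \<open>b\<close>.\<close>

lemma card_gaps_below_bead:
  "is_partition xs \<Longrightarrow> b \<in> beads xs \<Longrightarrow> card (- beads xs \<inter> {..<b}) \<in> set xs"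
proof (induction xs)
  case (Cons x xs)
  have part: "is_partition xs" using Cons.prems by (simp add: is_partition_Cons)
  have le: "b \<le> x + length xs"
    using beads_less_top_bound[OF Cons.prems] by simp
  \<comment> \<open>The new top bead lies at or above \<open>b\<close>, so it does not affect the gaps below \<open>b\<close>.\<close>
  then have eq: "- beads (x # xs) \<inter> {..<b} = - beads xs \<inter> {..<b}" by auto
  show ?case
  proof (cases "b \<in> beads xs")
    case True
    then show ?thesis using Cons.IH[OF part] eq by simp
  next
    case False
    then have "b = x + length xs" using Cons.prems by simp
    then show ?thesis
      using card_gaps_below_new_bead[OF Cons.prems(1)] eq by simp
  qed
qed simp

text \<open>
  Since \<open>b - t\<close> is not a gap, the gaps below the new bead \<open>b\<close> are those in the window and those below
  the bead \<open>b - t\<close>; there are none of the latter kind when \<open>b < t\<close>.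
\<close>

lemma card_window_eq_part_difference:
  assumes "0 < t" and "core_partition t (x # xs)"
  shows "\<exists>y\<in>insert 0 (set xs). card (window t (- beads xs) (x + length xs)) + y = x"
proof -
  let ?N = "- beads xs" and ?b = "x + length xs"
  have adm: "admissible t ?N ?b" and part: "is_partition (x # xs)"
    using assms(2) core_partition_Cons_admissible[OF assms(1)] core_partition_Cons[OF assms(1)]
    by blast+
  have "?N \<inter> {..<?b} = window t ?N ?b \<union> (?N \<inter> {..<?b - t})"
    using adm by (force simp: window_def admissible_def)
  moreover have "card (window t ?N ?b \<union> (?N \<inter> {..<?b - t})) =
      card (window t ?N ?b) + card (?N \<inter> {..<?b - t})"
    by (rule card_Un_disjoint) (auto simp: window_def)
  ultimately have sum: "card (window t ?N ?b) + card (?N \<inter> {..<?b - t}) = x"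
    using card_gaps_below_new_bead[OF part] by simp
  have "card (?N \<inter> {..<?b - t}) \<in> insert 0 (set xs)"
  proof (cases "t \<le> ?b")
    case True
    then have "?b - t \<in> beads xs" using adm by (force simp: admissible_def)
    then show ?thesis
      using card_gaps_below_bead part by (simp add: is_partition_Cons)
  qed simp
  with sum show ?thesis by blast
qed

text \<open>
  Going upwards, the difference between the top part and its entry is 0 or a lower part, which is
  already known to be divisible by \<open>d\<close>.
\<close>

lemma dvd_short_hooks_iff:
  assumes "0 < t"
  shows "core_partition t xs \<Longrightarrow> (\<forall>w\<in>set (short_hooks t xs). d dvd w) \<longleftrightarrow> (\<forall>x\<in>set xs. d dvd x)"
proof (induction xs)
  case (Cons x xs)
  let ?w = "card (window t (- beads xs) (x + length xs))"
  obtain y where y: "y \<in> insert 0 (set xs)" "?w + y = x"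
    using card_window_eq_part_difference[OF assms Cons.prems] by blast
  have "d dvd ?w \<longleftrightarrow> d dvd x" if "\<forall>x\<in>set xs. d dvd x"
    using y that dvd_add_left_iff[of d y ?w] by auto
  then show ?case
    using Cons by (auto simp: core_partition_Cons_admissible[OF assms])
qed simp

text \<open>
  For \<open>d = 1\<close> this is the correspondence of Lapointe and Morse between \<open>t\<close>-cores and partitions with
  parts at most \<open>t - 1\<close>, restricted to a fixed number of parts.
\<close>

lemma bij_betw_short_hooks_dvd:
  assumes "0 < t"
  shows "bij_betw (short_hooks t)
    {xs. core_partition t xs \<and> length xs = l \<and> (\<forall>x\<in>set xs. d dvd x)}
    {ws. is_partition ws \<and> (\<forall>w\<in>set ws. w < t) \<and> length ws = l \<and> (\<forall>w\<in>set ws. d dvd w)}"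
    (is "bij_betw _ ?E ?V")
proof (rule bij_betw_imageI)
  show "inj_on (short_hooks t) ?E"
    using short_hooks_inj[OF assms] by (auto simp: inj_on_def)
  show "short_hooks t ` ?E = ?V"
  proof (intro equalityI subsetI)
    fix ws assume "ws \<in> ?V"
    then obtain xs where xs: "core_partition t xs" "short_hooks t xs = ws"
      using short_hooks_surj[OF assms] by blast
    then have "xs \<in> ?E"
      using \<open>ws \<in> ?V\<close> dvd_short_hooks_iff[OF assms xs(1), of d] by auto
    then show "ws \<in> short_hooks t ` ?E" using xs(2) by blast
  next
    fix ws assume "ws \<in> short_hooks t ` ?E"
    then show "ws \<in> ?V"
      using short_hooks_bounded_partition[OF assms] dvd_short_hooks_iff[OF assms, of _ d] by auto
  qed
qed

lemma bij_betw_double: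
  "bij_betw (map ((*) 2)) {ws. is_partition ws \<and> (\<forall>w\<in>set ws. w < t) \<and> length ws = l}
    {ws. is_partition ws \<and> (\<forall>w\<in>set ws. w < 2 * t) \<and> length ws = l \<and> (\<forall>w\<in>set ws. even w)}"
  (is "bij_betw _ ?A ?B")
proof (rule bij_betw_byWitness[where f' = "map (\<lambda>w. w div 2)"])
  show "map ((*) 2) ` ?A \<subseteq> ?B"
    by (auto simp: is_partition_def sorted_wrt_map)
  show "map (\<lambda>w. w div 2) ` ?B \<subseteq> ?A"
  proof
    fix ws assume "ws \<in> map (\<lambda>w. w div 2) ` ?B"
    then obtain vs where vs: "ws = map (\<lambda>w. w div 2) vs" "vs \<in> ?B" by blast
    have "sorted_wrt (\<lambda>v w. w div 2 \<le> v div 2) vs"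
      by (rule sorted_wrt_mono_rel[of _ "(\<ge>)"]) (use vs in \<open>auto simp: is_partition_def div_le_mono\<close>)
    then show "ws \<in> ?A"
      using vs by (fastforce simp: is_partition_def sorted_wrt_map elim!: evenE)
  qed
qed (auto simp: map_idI)

theorem corollary2p9:
  fixes t l :: nat
  assumes "0 < t" and "0 < l"
  shows "finite {xs. core_partition (2 * t) xs \<and> length xs = l \<and> (\<forall>x\<in>set xs. even x)}
       \<and> finite {xs. core_partition t xs \<and> length xs = l}
       \<and> card {xs. core_partition (2 * t) xs \<and> length xs = l \<and> (\<forall>x\<in>set xs. even x)}
         = card {xs. core_partition t xs \<and> length xs = l}"
proof -
  let ?E = "{xs. core_partition (2 * t) xs \<and> length xs = l \<and> (\<forall>x\<in>set xs. even x)}"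
  let ?C = "{xs. core_partition t xs \<and> length xs = l}"
  let ?W = "{ws. is_partition ws \<and> (\<forall>w\<in>set ws. w < t) \<and> length ws = l}"
  let ?V = "{ws. is_partition ws \<and> (\<forall>w\<in>set ws. w < 2 * t) \<and> length ws = l \<and> (\<forall>w\<in>set ws. even w)}"
  have "0 < 2 * t" using assms by simp
  have E: "bij_betw (short_hooks (2 * t)) ?E ?V"
    by (rule bij_betw_short_hooks_dvd[OF \<open>0 < 2 * t\<close>])
  have C: "bij_betw (short_hooks t) ?C ?W"
    using bij_betw_short_hooks_dvd[OF assms(1), of l 1] by simp
  have D: "bij_betw (map ((*) 2)) ?W ?V"
    by (rule bij_betw_double)
  have "finite ?W"
    by (rule finite_subset[OF _ finite_lists_length_eq[of "{..<t}" l]]) auto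
  then show ?thesis
    using bij_betw_finite[OF C] bij_betw_finite[OF D] bij_betw_finite[OF E]
      bij_betw_same_card[OF C] bij_betw_same_card[OF D] bij_betw_same_card[OF E] by simp
qed

end
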